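(* Let $G$ be a saturated weakly branch group on a binary tree $\mathcal T$. Then $G$ has the $R_\infty$-property, i.e. $R(\phi)=\infty$ for every automorphism $\phi$ of $G$.
   Context: Reidemeister numbers: for an automorphism $\phi$ of a group $G$, elements $x,y\in G$ are $\phi$-conjugate if $y=gx\phi(g^{-1})$ for some $g\in G$; $R(\phi)$ is the number of equivalence classes (Reidemeister classes). Trees: $\mathcal T$ is the rooted binary tree (every vertex has exactly two children); the root is at level $0$; $\mathcal T_v$ is the subtree with root $v$. Weakly branch: a group $G$ acting faithfully on $\mathcal T$ (by rooted tree automorphisms) is weakly branch if for every vertex $v$ there is an element of $G$ acting nontrivially on $\mathcal T_v$ and trivially off it. Saturated: for every integer $n\ge 0$ there is a characteristic subgroup $H_n\subset G$ acting trivially on the $n$-th level of $\mathcal T$ and level-transitively (i.e. transitively on every level) on each subtree $\mathcal T_v$ with $v$ in the $n$-th level. *)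

theory Defs
  imports "HOL-Algebra.Group_Action" "HOL-Library.Extended_Nat"
begin

text \<open>
  The vertices of the rooted binary tree are the finite words over a two-letter alphabet:
  the root is the empty word, and the two children of \<open>v\<close> are
  \<open>v @ [False]\<close> and \<open>v @ [True]\<close>. The level of a vertex is its length.
\<close>

type_synonym vertex = "bool list"

definition tree_adj :: "vertex \<Rightarrow> vertex \<Rightarrow> bool" where
  "tree_adj v w \<longleftrightarrow> (\<exists>b. w = v @ [b]) \<or> (\<exists>b. v = w @ [b])"

definition rooted_tree_aut :: "(vertex \<Rightarrow> vertex) \<Rightarrow> bool" where
  "rooted_tree_aut f \<longleftrightarrow> bij f \<and> f [] = [] \<and> (\<forall>v w. tree_adj (f v) (f w) \<longleftrightarrow> tree_adj v w)"

definition level :: "nat \<Rightarrow> vertex set" where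
  "level n = {v. length v = n}"

definition subtree :: "vertex \<Rightarrow> vertex set" where
  "subtree v = {v @ u | u. True}"

text \<open>Level \<open>k\<close> of the tree \<open>subtree v\<close>, whose root \<open>v\<close> is at its level \<open>0\<close>.\<close>

definition subtree_level :: "vertex \<Rightarrow> nat \<Rightarrow> vertex set" where
  "subtree_level v k = {w \<in> subtree v. length w = length v + k}"

locale tree_group = faithful_action G "UNIV :: vertex set" \<alpha>
  for G (structure) and \<alpha> +
  assumes tree_aut: "g \<in> carrier G \<Longrightarrow> rooted_tree_aut (\<alpha> g)"

locale weakly_branch_group = tree_group +
  assumes weakly_branch:
    "\<exists>g \<in> carrier G. (\<exists>w \<in> subtree v. \<alpha> g w \<noteq> w) \<and> (\<forall>w. w \<notin> subtree v \<longrightarrow> \<alpha> g w = w)"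

definition characteristic_subgroup :: "'a set \<Rightarrow> ('a, 'b) monoid_scheme \<Rightarrow> bool" where
  "characteristic_subgroup H G \<longleftrightarrow> subgroup H G \<and> (\<forall>\<psi> \<in> iso G G. \<psi> ` H = H)"

locale saturated_weakly_branch_group = weakly_branch_group +
  assumes saturated:
    "\<exists>H. characteristic_subgroup H G
       \<and> (\<forall>h \<in> H. \<forall>v \<in> level n. \<alpha> h v = v)
       \<and> (\<forall>v \<in> level n. \<forall>k. \<forall>x \<in> subtree_level v k. \<forall>y \<in> subtree_level v k.
             \<exists>h \<in> H. \<alpha> h x = y)"

definition twisted_conj :: "('a, 'b) monoid_scheme \<Rightarrow> ('a \<Rightarrow> 'a) \<Rightarrow> ('a \<times> 'a) set" where
  "twisted_conj G \<phi> = {(x, y). x \<in> carrier G \<and> y \<in> carrier G \<and>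
     (\<exists>g \<in> carrier G. y = g \<otimes>\<^bsub>G\<^esub> x \<otimes>\<^bsub>G\<^esub> \<phi> (inv\<^bsub>G\<^esub> g))}"

lemma equiv_twisted_conj:
  assumes "group G" and phi: "\<phi> \<in> hom G G"
  shows "equiv (carrier G) (twisted_conj G \<phi>)"
proof -
  interpret group G by fact
  interpret phi: group_hom G G \<phi>
    using phi by (simp add: group_hom_def group_hom_axioms_def is_group)
  show ?thesis
  proof (rule equivI)
    show "twisted_conj G \<phi> \<subseteq> carrier G \<times> carrier G"
      by (auto simp: twisted_conj_def)
    show "refl_on (carrier G) (twisted_conj G \<phi>)"
      by (auto simp: refl_on_def twisted_conj_def intro!: bexI[of _ "\<one>\<^bsub>G\<^esub>"])
    show "sym (twisted_conj G \<phi>)"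
    proof (rule symI)
      fix x y assume "(x, y) \<in> twisted_conj G \<phi>"
      then obtain g where g: "g \<in> carrier G" "x \<in> carrier G" "y \<in> carrier G"
        "y = g \<otimes>\<^bsub>G\<^esub> x \<otimes>\<^bsub>G\<^esub> \<phi> (inv\<^bsub>G\<^esub> g)"
        by (auto simp: twisted_conj_def)
      then have "x = inv\<^bsub>G\<^esub> g \<otimes>\<^bsub>G\<^esub> y \<otimes>\<^bsub>G\<^esub> \<phi> (inv\<^bsub>G\<^esub> (inv\<^bsub>G\<^esub> g))"
        by (simp add: m_assoc inv_solve_left)
      then show "(y, x) \<in> twisted_conj G \<phi>"
        using g(1-3) unfolding twisted_conj_def by (blast intro: inv_closed)
    qed
    show "trans (twisted_conj G \<phi>)"
    proof (rule transI)
      fix x y z assume "(x, y) \<in> twisted_conj G \<phi>" "(y, z) \<in> twisted_conj G \<phi>"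
      then obtain g h where gh: "g \<in> carrier G" "h \<in> carrier G" "x \<in> carrier G" "z \<in> carrier G"
        "z = h \<otimes>\<^bsub>G\<^esub> (g \<otimes>\<^bsub>G\<^esub> x \<otimes>\<^bsub>G\<^esub> \<phi> (inv\<^bsub>G\<^esub> g)) \<otimes>\<^bsub>G\<^esub> \<phi> (inv\<^bsub>G\<^esub> h)"
        by (auto simp: twisted_conj_def)
      then have "z = (h \<otimes>\<^bsub>G\<^esub> g) \<otimes>\<^bsub>G\<^esub> x \<otimes>\<^bsub>G\<^esub> \<phi> (inv\<^bsub>G\<^esub> (h \<otimes>\<^bsub>G\<^esub> g))"
        by (simp add: m_assoc inv_mult_group)
      then show "(x, z) \<in> twisted_conj G \<phi>"
        using gh(1-4) unfolding twisted_conj_def by (blast intro: m_closed)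
    qed
  qed
qed

definition reidemeister_classes :: "('a, 'b) monoid_scheme \<Rightarrow> ('a \<Rightarrow> 'a) \<Rightarrow> 'a set set" where
  "reidemeister_classes G \<phi> = carrier G // twisted_conj G \<phi>"

definition reidemeister_number :: "('a, 'b) monoid_scheme \<Rightarrow> ('a \<Rightarrow> 'a) \<Rightarrow> enat" where
  "reidemeister_number G \<phi> =
     (if finite (reidemeister_classes G \<phi>) then enat (card (reidemeister_classes G \<phi>)) else \<infinity>)"

definition R_infinity :: "('a, 'b) monoid_scheme \<Rightarrow> bool" where
  "R_infinity G \<longleftrightarrow> (\<forall>\<phi> \<in> iso G G. reidemeister_number G \<phi> = \<infinity>)"

end

theory Submission
  imports Defs
begin

text \<open>
  Let \<open>\<phi>\<close> be an automorphism of \<open>G\<close>. The proof first realizes \<open>\<phi>\<close> geometrically and then counts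
  in finite quotients.

  \<^bold>\<open>Rigidity\<close> (\<open>automorphism_induced_by_tree_aut\<close>). Some automorphism \<open>t\<close> of the tree satisfies
  \<open>\<alpha> (\<phi> g) = t \<circ> \<alpha> g \<circ> t\<inverse>\<close>. To find \<open>t v\<close>, look at the image under \<open>\<phi>\<close> of the rigid stabilizer of
  \<open>v\<close>, the group of elements that act trivially off the subtree of \<open>v\<close>. If the level of \<open>v\<close> is \<open>n\<close>,
  then below which vertices of level \<open>n\<close> does this image act nontrivially? Below at least one, and
  the crux (\<open>not_both_touch\<close>) is that the images for distinct \<open>v\<close> and \<open>v'\<close> never act nontrivially
  below the same vertex. The crux uses the characteristic subgroup of level \<open>n\<close>, whose transitivity
  spreads such nontrivial action over a whole level, and the fact that in a weakly branch group
  rigid stabilizers meet subgroups of finite index in nonabelian groups. As there are as many rigid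
  stabilizers as vertices on a level, there is exactly one such vertex; it is \<open>t v\<close>.

  \<^bold>\<open>Reformulation.\<close> By rigidity, \<open>x \<mapsto> \<alpha> x \<circ> t\<close> carries Reidemeister classes of \<open>\<phi>\<close> to the classes of
  the coset \<open>\<Gamma> t\<close> under conjugation by the group \<open>\<Gamma>\<close> of all \<open>\<alpha> g\<close>. It remains to show that there are
  infinitely many of these (\<open>infinite_conj_classes_coset\<close>).

  \<^bold>\<open>Large centralizers.\<close> Suppose \<open>s \<in> \<Gamma> t\<close> fixes a vertex \<open>v\<close> of level \<open>n\<close>. Because the tree is
  binary, \<open>s\<close> also fixes the sibling of every vertex on the path from the root to \<open>v\<close>. This gives
  \<open>n\<close> disjoint subtrees invariant under \<open>s\<close>. Restrict all actions to the first \<open>m\<close> levels, with \<open>m\<close>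
  large. Each of these subtrees then supports a nontrivial finite 2-group, on which \<open>s\<close> acts by
  conjugation as a permutation of 2-power order, and so supports a nontrivial element commuting with
  \<open>s\<close>. Hence the centralizer of \<open>s\<close> has at least \<open>2\<^sup>n\<close> elements, and the class of \<open>s\<close> is at most the
  \<open>2\<^sup>n\<close>-th part of the truncated coset (\<open>class_density_small\<close>); this share is called its density.

  \<^bold>\<open>Counting.\<close> Suppose there were finitely many classes. For some \<open>N\<close>, each class either
  contains elements with fixed vertices on arbitrarily deep levels, and so has arbitrarily small
  density, or has no element with a fixed vertex on level \<open>N\<close>. Elements fixing a given vertex of
  level \<open>N\<close> therefore lie in finitely many classes of arbitrarily small density. But by
  level-transitivity they make up at least the \<open>2\<^sup>N\<close>-th part of the coset, a contradiction.
\<close>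

section \<open>Permutation groups and finite 2-groups\<close>

abbreviation perm_inv :: "('v \<Rightarrow> 'v) \<Rightarrow> 'v \<Rightarrow> 'v" where
  "perm_inv f \<equiv> inv_into UNIV f"

definition conj_by :: "('v \<Rightarrow> 'v) \<Rightarrow> ('v \<Rightarrow> 'v) \<Rightarrow> 'v \<Rightarrow> 'v" where
  "conj_by p s = p \<circ> s \<circ> perm_inv p"

lemma bij_perm_inv: "bij f \<Longrightarrow> f (perm_inv f x) = x" "bij f \<Longrightarrow> perm_inv f (f x) = x"
  by (simp_all add: bij_is_surj surj_f_inv_f bij_is_inj)

lemma conj_by_eq_iff: "bij p \<Longrightarrow> conj_by p s = r \<longleftrightarrow> p \<circ> s = r \<circ> p"
  unfolding conj_by_def fun_eq_iff comp_apply by (metis bij_perm_inv)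

lemma conj_by_comp: "bij p \<Longrightarrow> bij q \<Longrightarrow> conj_by (p \<circ> q) s = conj_by p (conj_by q s)"
  by (simp add: conj_by_def o_inv_distrib comp_assoc)

lemma conj_by_id [simp]: "conj_by id s = s"
  by (simp add: conj_by_def)

lemma funpow_conj_by: "bij s \<Longrightarrow> (conj_by s ^^ k) p = conj_by (s ^^ k) p"
  by (induction k) (simp_all add: conj_by_comp bij_fn)

locale permutation_group =
  fixes P :: "('v \<Rightarrow> 'v) set"
  assumes bij: "p \<in> P \<Longrightarrow> bij p"
    and id_mem: "id \<in> P"
    and comp_mem: "p \<in> P \<Longrightarrow> q \<in> P \<Longrightarrow> p \<circ> q \<in> P"
    and inv_mem: "p \<in> P \<Longrightarrow> perm_inv p \<in> P"

context permutation_group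
begin

lemma conj_class_eq:
  assumes "p \<in> P"
  shows "(\<lambda>q. conj_by q (conj_by p s)) ` P = (\<lambda>q. conj_by q s) ` P"
proof -
  have "(\<lambda>q. conj_by q (conj_by p s)) ` P = (\<lambda>q. conj_by (q \<circ> p) s) ` P"
    using assms by (intro image_cong) (simp_all add: conj_by_comp bij)
  also have "\<dots> = (\<lambda>q. conj_by q s) ` P"
  proof (intro equalityI image_subsetI)
    fix q assume q: "q \<in> P"
    then show "conj_by (q \<circ> p) s \<in> (\<lambda>q. conj_by q s) ` P"
      using assms comp_mem by blast
    have "q = (q \<circ> perm_inv p) \<circ> p"
      using assms by (simp add: fun_eq_iff bij bij_perm_inv)
    then show "conj_by q s \<in> (\<lambda>q. conj_by (q \<circ> p) s) ` P"
      using assms comp_mem[OF q inv_mem[OF assms]]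
      by (metis (no_types, lifting) image_eqI)
  qed
  finally show ?thesis .
qed

text \<open>
  Each fibre of the map from \<open>P\<close> onto the conjugacy class of \<open>s\<close> contains a translate of the
  centralizer. Here \<open>s\<close> is any function, in particular an element of a coset of \<open>P\<close>.
\<close>

lemma card_class_centralizer:
  assumes "finite P"
  shows "card ((\<lambda>p. conj_by p s) ` P) * card {z \<in> P. z \<circ> s = s \<circ> z} \<le> card P"
proof -
  let ?Z = "{z \<in> P. z \<circ> s = s \<circ> z}" and ?f = "\<lambda>p. conj_by p s"
  have fibre: "card ?Z \<le> card {p \<in> P. ?f p = d}" if d: "d \<in> ?f ` P" for d
  proof -
    obtain p where p: "p \<in> P" "d = ?f p" using d by auto
    have sub: "(\<lambda>z. p \<circ> z) ` ?Z \<subseteq> {p \<in> P. ?f p = d}"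
    proof safe
      fix z assume z: "z \<in> P" "z \<circ> s = s \<circ> z"
      show "p \<circ> z \<in> P" using p z comp_mem by blast
      have "conj_by z s = s" using z by (simp add: conj_by_eq_iff bij)
      then show "?f (p \<circ> z) = d" using p z by (simp add: conj_by_comp bij)
    qed
    have inj: "inj_on (\<lambda>z. p \<circ> z) ?Z"
      using p(1) by (auto simp: inj_on_def fun_eq_iff dest!: bij) (metis bij_perm_inv(2))
    show ?thesis
      using card_mono[OF _ sub] card_image[OF inj] assms by simp
  qed
  have "card (?f ` P) * card ?Z = (\<Sum>d\<in>?f ` P. card ?Z)" by simp
  also have "\<dots> \<le> (\<Sum>d\<in>?f ` P. card {p \<in> P. ?f p = d})"
    by (rule sum_mono) (rule fibre)
  also have "\<dots> = card P"
    using sum.group[OF assms finite_imageI[OF assms], of ?f ?f "\<lambda>_. 1::nat"] by simp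
  finally show ?thesis .
qed

end

lemma even_card_moved:
  assumes "finite Y" "\<And>y. y \<in> Y \<Longrightarrow> g y \<in> Y" "\<And>y. y \<in> Y \<Longrightarrow> g (g y) = y" "\<And>y. y \<in> Y \<Longrightarrow> g y \<noteq> y"
  shows "even (card Y)"
  using assms
proof (induction "card Y" arbitrary: Y rule: less_induct)
  case less
  show ?case
  proof (cases "Y = {}")
    case False
    then obtain y where y: "y \<in> Y" by auto
    let ?Y = "Y - {y, g y}"
    have two: "{y, g y} \<subseteq> Y" "card {y, g y} = 2"
      using y less.prems(2) less.prems(4)[OF y] by auto
    have card: "card Y = card ?Y + 2"
      using card_Diff_subset[OF _ two(1)] card_mono[OF less.prems(1) two(1)] two(2) by simp
    have "even (card ?Y)"
    proof (rule less.hyps)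
      show "card ?Y < card Y" using card by simp
      fix z assume z: "z \<in> ?Y"
      then show "g z \<in> ?Y" using less.prems y by (metis Diff_iff insert_iff empty_iff)
    qed (use less.prems in auto)
    then show ?thesis using card by simp
  qed simp
qed

lemma even_card_fixed_involution:
  assumes "finite Y" "\<And>y. y \<in> Y \<Longrightarrow> g y \<in> Y" "\<And>y. y \<in> Y \<Longrightarrow> g (g y) = y"
  shows "even (card {y \<in> Y. g y = y}) \<longleftrightarrow> even (card Y)"
proof -
  have "even (card {y \<in> Y. g y \<noteq> y})"
    by (rule even_card_moved[of _ g]) (use assms in auto)
  moreover have "card Y = card {y \<in> Y. g y = y} + card {y \<in> Y. g y \<noteq> y}"
    using assms(1) by (subst card_Un_disjoint[symmetric]) (auto intro: arg_cong[where f = card])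
  ultimately show ?thesis by simp
qed

text \<open>
  The orbits of \<open>f\<close> have 2-power length, so those with more than one element contribute evenly. In
  the induction, passing to the fixed points of the involution \<open>f ^^ 2 ^ j\<close> keeps the parity, and on
  these fixed points the \<open>2 ^ j\<close>-th power of \<open>f\<close> is trivial.
\<close>

lemma even_card_fixed:
  assumes "finite Y" "\<And>y. y \<in> Y \<Longrightarrow> f y \<in> Y" "\<And>y. y \<in> Y \<Longrightarrow> (f ^^ (2 ^ j)) y = y"
  shows "even (card {y \<in> Y. f y = y}) \<longleftrightarrow> even (card Y)"
  using assms
proof (induction j arbitrary: Y)
  case 0
  then have "{y \<in> Y. f y = y} = Y" by auto
  then show ?case by simp
next
  case (Suc j)
  let ?h = "f ^^ (2 ^ j)" and ?Y = "{y \<in> Y. (f ^^ (2 ^ j)) y = y}"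
  have iter: "(f ^^ k) y \<in> Y" if "y \<in> Y" for k y
    using that by (induction k) (auto simp: Suc.prems)
  have "even (card ?Y) \<longleftrightarrow> even (card Y)"
  proof (rule even_card_fixed_involution)
    fix y assume "y \<in> Y"
    moreover have "f ^^ (2 ^ Suc j) = ?h \<circ> ?h"
      by (simp add: mult_2 funpow_add)
    ultimately show "?h (?h y) = y" using Suc.prems(3)[of y] by simp
  qed (use Suc.prems iter in auto)
  moreover have "even (card {y \<in> ?Y. f y = y}) \<longleftrightarrow> even (card ?Y)"
  proof (rule Suc.IH)
    fix y assume "y \<in> ?Y"
    then show "f y \<in> ?Y" using Suc.prems(2) by (simp add: funpow_swap1[symmetric])
  qed (use Suc.prems in auto)
  moreover have "{y \<in> ?Y. f y = y} = {y \<in> Y. f y = y}"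
  proof -
    have "(f ^^ k) y = y" if "f y = y" for k y using that by (induction k) auto
    then show ?thesis by auto
  qed
  ultimately show ?case by simp
qed

text \<open>
  A power of \<open>p\<close> is an involution, and composition with it pairs off the elements of \<open>P\<close>.
\<close>

lemma (in permutation_group) even_order:
  assumes "finite P" "p \<in> P" "p \<noteq> id" "p ^^ (2 ^ j) = id"
  shows "even (card P)"
proof -
  have pow: "p ^^ k \<in> P" for k
    using assms(2) by (induction k) (simp_all add: comp_mem id_mem[unfolded id_def] id_def)
  define i where "i = (LEAST i. p ^^ (2 ^ i) = id)"
  have i: "p ^^ (2 ^ i) = id" unfolding i_def using assms(4) by (rule LeastI)
  with assms(3) obtain l where l: "i = Suc l" by (cases i) (auto simp: fun_eq_iff)
  define z where "z = p ^^ (2 ^ l)"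
  have z: "z \<in> P" "z \<noteq> id"
    using pow not_less_Least[of l "\<lambda>i. p ^^ (2 ^ i) = id"] l unfolding z_def i_def by auto
  have zz: "z \<circ> z = id"
    using i unfolding l z_def by (simp add: mult_2 funpow_add)
  show ?thesis
  proof (rule even_card_moved[of _ "\<lambda>q. z \<circ> q"])
    fix q assume q: "q \<in> P"
    show "z \<circ> q \<in> P" using z q comp_mem by blast
    show "z \<circ> (z \<circ> q) = q" using zz by (simp add: comp_assoc[symmetric])
    show "z \<circ> q \<noteq> q"
    proof
      assume "z \<circ> q = q"
      then have "z x = x" for x using bij[OF q] by (metis comp_apply bij_perm_inv(1))
      then show False using z by auto
    qed
  qed fact
qed

text \<open>
  The number of elements fixed by conjugation with \<open>s\<close> has the parity of the order of the group,
  so it is even; as the identity is fixed, a second element is fixed too.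
\<close>

lemma (in permutation_group) two_group_nontrivial_centralized:
  assumes "finite P" and p: "p \<in> P" "p \<noteq> id" "p ^^ (2 ^ j) = id"
    and s: "bij s" "s ^^ (2 ^ i) = id" and normal: "\<And>p. p \<in> P \<Longrightarrow> conj_by s p \<in> P"
  obtains c where "c \<in> P" "c \<noteq> id" "c \<circ> s = s \<circ> c"
proof -
  let ?F = "{c \<in> P. conj_by s c = c}"
  have "even (card ?F)"
    using even_card_fixed[of P "conj_by s" i] even_order[OF assms(1) p] assms(1) normal s
    by (simp add: funpow_conj_by)
  moreover have "id \<in> ?F" using id_mem s by (simp add: conj_by_eq_iff)
  ultimately have "?F \<noteq> {id}" by auto
  then obtain c where "c \<in> ?F" "c \<noteq> id" using \<open>id \<in> ?F\<close> by blast
  then show ?thesis using that s by (auto simp: conj_by_eq_iff)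
qed

section \<open>Automorphisms of the binary tree and their truncations\<close>

lemma subtree_iff: "w \<in> subtree v \<longleftrightarrow> take (length v) w = v"
  unfolding subtree_def by (auto intro!: exI[of _ "drop (length v) w"]) (metis append_take_drop_id)

lemma subtree_take: "subtree v \<subseteq> subtree (take k v)"
proof
  fix w assume "w \<in> subtree v"
  then obtain u where "w = v @ u" by (auto simp: subtree_def)
  then have "w = take k v @ (drop k v @ u)" by (simp flip: append_assoc)
  then show "w \<in> subtree (take k v)" unfolding subtree_def by blast
qed

lemma disjoint_subtrees: "length u = length v \<Longrightarrow> u \<noteq> v \<Longrightarrow> w \<in> subtree u \<Longrightarrow> w \<notin> subtree v"
  by (auto simp: subtree_iff)

lemma tree_adj_iff:
  "tree_adj v w \<longleftrightarrow> length w = Suc (length v) \<and> take (length v) w = v \<or>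
     length v = Suc (length w) \<and> take (length w) v = w"
proof -
  have "(\<exists>b. w = v @ [b]) \<longleftrightarrow> length w = Suc (length v) \<and> take (length v) w = v" for v w :: vertex
    by (auto simp: length_Suc_conv_rev) 
  then show ?thesis unfolding tree_adj_def by simp
qed

text \<open>
  Among the neighbours of \<open>f v\<close>, the parent is the image of the parent of \<open>v\<close>, so by injectivity
  children go to children.
\<close>

lemma rooted_tree_aut_child:
  assumes f: "rooted_tree_aut f"
  shows "\<exists>c. f (v @ [b]) = f v @ [c]"
proof (induction v arbitrary: b rule: rev_induct)
  case Nil
  have "tree_adj [] [b]" by (simp add: tree_adj_def)
  then have "tree_adj (f []) (f [b])" using f unfolding rooted_tree_aut_def by blast
  moreover have "f [] = []" using f by (simp add: rooted_tree_aut_def)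
  ultimately show ?case by (simp add: tree_adj_def)
next
  case (snoc a u)
  have "tree_adj (f (u @ [a])) (f (u @ [a] @ [b]))"
    using f by (simp add: rooted_tree_aut_def tree_adj_def)
  moreover obtain c where c: "f (u @ [a]) = f u @ [c]" using snoc by auto
  moreover have "f (u @ [a] @ [b]) \<noteq> f u"
    using f by (simp add: rooted_tree_aut_def bij_def inj_eq)
  ultimately show ?case by (auto simp: tree_adj_def)
qed

text \<open>
  Adjacency is awkward in calculations. Prefixes replace it: \<open>take k v\<close> is the ancestor of \<open>v\<close> on
  level \<open>k\<close>, so the conditions say that levels and ancestors are preserved.
\<close>

lemma rooted_tree_aut_iff:
  "rooted_tree_aut f \<longleftrightarrow>
     bij f \<and> (\<forall>v. length (f v) = length v) \<and> (\<forall>k v. f (take k v) = take k (f v))"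
    (is "_ \<longleftrightarrow> ?R")
proof
  assume f: "rooted_tree_aut f"
  have len: "length (f v) = length v" for v
  proof (induction v rule: rev_induct)
    case Nil
    then show ?case using f by (simp add: rooted_tree_aut_def)
  next
    case (snoc b v)
    then show ?case using rooted_tree_aut_child[OF f, of v b] by auto
  qed
  have "f (take k v) = take k (f v)" for k v
  proof (induction v rule: rev_induct)
    case Nil
    then show ?case using f by (simp add: rooted_tree_aut_def)
  next
    case (snoc b v)
    obtain c where c: "f (v @ [b]) = f v @ [c]" using rooted_tree_aut_child[OF f] by blast
    show ?case
    proof (cases "k \<le> length v")
      case True
      then show ?thesis using snoc c len by simp
    next
      case False
      then show ?thesis using c len by simp
    qed
  qed
  then show ?R using f len by (simp add: rooted_tree_aut_def)
next
  assume R: ?R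
  then have "f [] = []" by (metis length_0_conv)
  moreover have "tree_adj (f v) (f w) \<longleftrightarrow> tree_adj v w" for v w
  proof -
    have "take (length v) (f w) = f v \<longleftrightarrow> take (length v) w = v" for v w
      using R by (metis bij_is_inj inj_eq)
    then show ?thesis using R by (simp add: tree_adj_iff)
  qed
  ultimately show "rooted_tree_aut f" using R by (simp add: rooted_tree_aut_def)
qed

lemma rooted_tree_autD:
  assumes "rooted_tree_aut f"
  shows "bij f" "length (f v) = length v" "f (take k v) = take k (f v)"
    "f v = f w \<longleftrightarrow> v = w" "f v \<in> subtree (f w) \<longleftrightarrow> v \<in> subtree w"
  using assms unfolding rooted_tree_aut_iff subtree_iff by (metis bij_is_inj inj_eq)+

lemma rooted_tree_aut_id: "rooted_tree_aut id"
  by (simp add: rooted_tree_aut_def)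

lemma rooted_tree_aut_comp: "rooted_tree_aut f \<Longrightarrow> rooted_tree_aut g \<Longrightarrow> rooted_tree_aut (f \<circ> g)"
  by (simp add: rooted_tree_aut_iff bij_comp)

lemma rooted_tree_aut_perm_inv:
  assumes "rooted_tree_aut f"
  shows "rooted_tree_aut (perm_inv f)"
proof -
  note f = assms[unfolded rooted_tree_aut_iff]
  have "length (perm_inv f v) = length v" for v
    using f by (metis bij_perm_inv(1))
  moreover have "perm_inv f (take k v) = take k (perm_inv f v)" for k v
    using f by (metis bij_perm_inv)
  ultimately show ?thesis using f by (simp add: rooted_tree_aut_iff bij_imp_bij_inv)
qed

lemma rooted_tree_aut_funpow: "rooted_tree_aut f \<Longrightarrow> rooted_tree_aut (f ^^ k)"
  by (induction k) (simp_all add: rooted_tree_aut_id[unfolded id_def] id_def rooted_tree_aut_comp)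

text \<open>
  If a power of \<open>f\<close> fixes level \<open>m\<close> pointwise, it can only swap siblings on the next level, and
  its square fixes that level as well.
\<close>

lemma funpow_two_power_fixes_level:
  assumes f: "rooted_tree_aut f"
  shows "length w = m \<Longrightarrow> (f ^^ (2 ^ m)) w = w"
proof (induction m arbitrary: w)
  case 0
  then show ?case using f by (simp add: rooted_tree_aut_def)
next
  case (Suc m)
  then obtain v b where w: "w = v @ [b]" "length v = m" by (metis length_Suc_conv_rev)
  let ?h = "f ^^ (2 ^ m)"
  have h: "rooted_tree_aut ?h" by (rule rooted_tree_aut_funpow[OF f])
  have child: "\<exists>c. ?h (v @ [b]) = v @ [c]" for b
    using rooted_tree_aut_child[OF h, of v b] Suc.IH[OF w(2)] by simp
  obtain c d where cd: "?h (v @ [b]) = v @ [c]" "?h (v @ [c]) = v @ [d]" using child by blast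
  have "d = b"
  proof (cases "b = c")
    case False
    then have "v @ [d] \<noteq> v @ [c]" using cd rooted_tree_autD(4)[OF h] by (metis last_snoc)
    then show ?thesis using False by auto
  qed (use cd in auto)
  moreover have "f ^^ (2 ^ Suc m) = ?h \<circ> ?h"
    by (simp add: mult_2 funpow_add)
  ultimately show ?case using cd w by simp
qed

text \<open>
  The action on the first \<open>m\<close> levels, extended to the whole tree by moving subtrees of level \<open>m\<close>
  rigidly. So truncating is a homomorphism from tree automorphisms to tree automorphisms.
\<close>

definition truncation :: "nat \<Rightarrow> (vertex \<Rightarrow> vertex) \<Rightarrow> vertex \<Rightarrow> vertex" where
  "truncation m f w = f (take m w) @ drop m w"

lemma truncation_id: "truncation m id = id"
  by (simp add: truncation_def fun_eq_iff)

lemma truncation_apply: "length w \<le> m \<Longrightarrow> truncation m f w = f w"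
  by (simp add: truncation_def)

lemma truncation_comp:
  assumes "rooted_tree_aut g"
  shows "truncation m (f \<circ> g) = truncation m f \<circ> truncation m g"
proof
  fix w
  have len: "length (g (take m w)) = min (length w) m" using rooted_tree_autD[OF assms] by simp
  show "truncation m (f \<circ> g) w = (truncation m f \<circ> truncation m g) w"
    using len by (cases "length w \<le> m") (auto simp: truncation_def)
qed

lemma truncation_perm_inv:
  assumes "rooted_tree_aut f"
  shows "perm_inv (truncation m f) = truncation m (perm_inv f)" "bij (truncation m f)"
proof -
  note f = rooted_tree_autD(1)[OF assms]
  have "truncation m f \<circ> truncation m (perm_inv f) = id"
    using truncation_comp[OF rooted_tree_aut_perm_inv[OF assms], of m f] surj_iff[THEN iffD1, OF bij_is_surj[OF f]]
    by (simp add: truncation_id)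
  moreover have "truncation m (perm_inv f) \<circ> truncation m f = id"
    using truncation_comp[OF assms, of m "perm_inv f"] f by (simp add: truncation_id bij_is_inj)
  ultimately show "perm_inv (truncation m f) = truncation m (perm_inv f)" "bij (truncation m f)"
    by (auto intro!: inv_equality o_bij simp: pointfree_idE)
qed

lemma truncation_conj_by:
  assumes "rooted_tree_aut f" "rooted_tree_aut g"
  shows "truncation m (conj_by f g) = conj_by (truncation m f) (truncation m g)"
  unfolding conj_by_def using assms
  by (simp add: truncation_perm_inv truncation_comp rooted_tree_aut_comp rooted_tree_aut_perm_inv)

lemma rooted_tree_aut_truncation:
  assumes f: "rooted_tree_aut f"
  shows "rooted_tree_aut (truncation m f)"
  unfolding rooted_tree_aut_iff
proof (intro conjI allI)
  show "bij (truncation m f)" by (rule truncation_perm_inv(2)[OF f])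
  show "length (truncation m f v) = length v" for v
    using rooted_tree_autD[OF f] by (simp add: truncation_def)
  show "truncation m f (take k v) = take k (truncation m f v)" for k v
    by (cases "k \<le> m")
      (auto simp: truncation_def rooted_tree_autD(2)[OF f] rooted_tree_autD(3)[OF f, symmetric]
        min_def drop_take)
qed

lemma truncation_funpow: "rooted_tree_aut f \<Longrightarrow> truncation m (f ^^ k) = truncation m f ^^ k"
  by (induction k) (simp_all add: truncation_id[unfolded id_def] id_def truncation_comp rooted_tree_aut_funpow)

lemma truncation_order:
  assumes f: "rooted_tree_aut f"
  shows "truncation m f ^^ (2 ^ m) = id"
proof
  fix w :: vertex
  have "(f ^^ (2 ^ m)) (take m w) = take m w"
  proof (cases "m \<le> length w")
    case True
    then show ?thesis by (intro funpow_two_power_fixes_level[OF f]) simp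
  next
    case False
    then have m: "(2::nat) ^ m = 2 ^ length w * 2 ^ (m - length w)" by (simp flip: power_add)
    have "((f ^^ (2 ^ length w)) ^^ k) w = w" for k
      by (induction k) (simp_all add: funpow_two_power_fixes_level[OF f])
    then show ?thesis using False unfolding m by (simp add: funpow_mult)
  qed
  then show "(truncation m f ^^ (2 ^ m)) w = id w"
    by (simp add: truncation_funpow[OF f, symmetric] truncation_def)
qed

lemma finite_truncations:
  assumes "\<And>f. f \<in> A \<Longrightarrow> rooted_tree_aut f"
  shows "finite (truncation m ` A)"
proof -
  let ?S = "{w :: vertex. length w \<le> m}"
  let ?E = "\<lambda>r w. r (take m w) @ drop m w"
  have S: "finite ?S"
    using finite_lists_length_le[of "UNIV :: bool set" m] by simp
  have "truncation m ` A \<subseteq> ?E ` (?S \<rightarrow>\<^sub>E ?S)"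
  proof
    fix p assume "p \<in> truncation m ` A"
    then obtain f where f: "f \<in> A" "p = truncation m f" by auto
    have "p = ?E (restrict f ?S)" by (simp add: f truncation_def fun_eq_iff)
    moreover have "restrict f ?S \<in> ?S \<rightarrow>\<^sub>E ?S"
      using rooted_tree_autD(2)[OF assms[OF f(1)]] by auto
    ultimately show "p \<in> ?E ` (?S \<rightarrow>\<^sub>E ?S)" by blast
  qed
  then show ?thesis using finite_PiE[OF S, of "\<lambda>_. ?S"] S finite_subset by blast
qed

lemma truncation_supported:
  assumes "\<And>w. w \<notin> subtree u \<Longrightarrow> f w = w" "w \<notin> subtree u"
  shows "truncation m f w = w"
proof -
  have "take m w \<notin> subtree u"
    using assms(2) by (auto simp: subtree_iff min_def split: if_splits)
  then show ?thesis using assms(1) by (simp add: truncation_def)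
qed

section \<open>Centralizers and conjugacy classes in a coset of a weakly branch group\<close>

lemma prefix_sibling:
  assumes "k < length v"
  shows "subtree (take k v @ [\<not> v ! k]) \<inter> subtree (take (Suc k) v) = {}"
    and "subtree (take k v @ [\<not> v ! k]) \<union> subtree (take (Suc k) v) \<subseteq> subtree (take k v)"
proof -
  have "take (Suc k) v = take k v @ [v ! k]" using assms by (rule take_Suc_conv_app_nth)
  then show "subtree (take k v @ [\<not> v ! k]) \<inter> subtree (take (Suc k) v) = {}"
    and "subtree (take k v @ [\<not> v ! k]) \<union> subtree (take (Suc k) v) \<subseteq> subtree (take k v)"
    by (auto simp: subtree_def)
qed

text \<open>
  In a binary tree, a fixed vertex whose parent is fixed leaves no place for its sibling to move
  to.
\<close>

lemma fixes_sibling: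
  assumes s: "rooted_tree_aut s" and fixed: "s v = v" and k: "k < length v"
  shows "s (take k v @ [\<not> v ! k]) = take k v @ [\<not> v ! k]"
proof -
  have p: "s (take j v) = take j v" for j using fixed rooted_tree_autD(3)[OF s] by simp
  have e: "take (Suc k) v = take k v @ [v ! k]" using k by (rule take_Suc_conv_app_nth)
  obtain c where c: "s (take k v @ [\<not> v ! k]) = take k v @ [c]"
    using rooted_tree_aut_child[OF s] p by metis
  moreover have "c \<noteq> v ! k"
  proof
    assume "c = v ! k"
    then have "s (take k v @ [\<not> v ! k]) = s (take (Suc k) v)" using c p[of "Suc k"] e by simp
    then show False using e rooted_tree_autD(4)[OF s] by simp
  qed
  ultimately show ?thesis by simp
qed

locale tree_permutation_group = permutation_group P for P :: "(vertex \<Rightarrow> vertex) set" +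
  assumes tree_aut: "p \<in> P \<Longrightarrow> rooted_tree_aut p"
begin

definition rist :: "vertex \<Rightarrow> (vertex \<Rightarrow> vertex) set" where
  "rist u = {p \<in> P. \<forall>w. w \<notin> subtree u \<longrightarrow> p w = w}"

lemma rist_group: "tree_permutation_group (rist u)"
proof
  fix p assume p: "p \<in> rist u"
  then show "bij p" and "rooted_tree_aut p" by (simp_all add: rist_def bij tree_aut)
  show "perm_inv p \<in> rist u"
    using p inv_mem[of p] by (auto simp: rist_def) (metis bij bij_perm_inv(2))
next
  show "id \<in> rist u" by (simp add: rist_def id_mem)
next
  fix p q assume "p \<in> rist u" "q \<in> rist u"
  then show "p \<circ> q \<in> rist u" by (simp add: rist_def comp_mem)
qed

lemma rist_mono: "subtree u \<subseteq> subtree v \<Longrightarrow> rist u \<subseteq> rist v"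
  by (auto simp: rist_def)

lemma rist_conj_by:
  assumes "\<And>p. p \<in> P \<Longrightarrow> conj_by s p \<in> P" and s: "rooted_tree_aut s" "s u = u" and p: "p \<in> rist u"
  shows "conj_by s p \<in> rist u"
proof -
  have "conj_by s p w = w" if "w \<notin> subtree u" for w
  proof -
    have w: "s (perm_inv s w) = w" using rooted_tree_autD(1)[OF s(1)] by (rule bij_perm_inv)
    then have "perm_inv s w \<notin> subtree u"
      using rooted_tree_autD(5)[OF s(1), of "perm_inv s w" u] s(2) that by simp
    then show ?thesis using p w by (simp add: rist_def conj_by_def)
  qed
  then show ?thesis using assms p by (simp add: rist_def)
qed

text \<open>
  Walking up from \<open>v\<close> to the root, each step doubles the number of known commuting elements: the
  sibling subtree added at that step supports a nontrivial commuting element, which can be used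
  or not.
\<close>

lemma card_centralizer_ge:
  assumes fin: "finite P" and order: "\<And>p. p \<in> P \<Longrightarrow> p ^^ (2 ^ i) = id"
    and s: "rooted_tree_aut s" "s ^^ (2 ^ j) = id" and normal: "\<And>p. p \<in> P \<Longrightarrow> conj_by s p \<in> P"
    and fixed: "s v = v"
    and nontriv: "\<And>k. k < length v \<Longrightarrow> rist (take k v @ [\<not> v ! k]) \<noteq> {id}"
  shows "2 ^ length v \<le> card {z \<in> P. z \<circ> s = s \<circ> z}"
proof -
  \<comment> \<open>Commuting elements supported below the \<open>k\<close>-th vertex on the path to \<open>v\<close>.\<close>
  define Z where "Z k = {z \<in> rist (take k v). z \<circ> s = s \<circ> z}" for k
  have finZ: "finite (Z k)" for k using fin by (auto simp: Z_def rist_def)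
  have doubling: "2 * card (Z (Suc k)) \<le> card (Z k)" if k: "k < length v" for k
  proof -
    let ?u = "take k v @ [\<not> v ! k]"
    interpret Y: tree_permutation_group "rist ?u" by (rule rist_group)
    have "rist ?u \<noteq> {id}" "id \<in> rist ?u" using nontriv[OF k] Y.id_mem by auto
    then obtain p where p: "p \<in> rist ?u" "p \<noteq> id" by blast
    obtain c where c: "c \<in> rist ?u" "c \<noteq> id" "c \<circ> s = s \<circ> c"
    proof (rule Y.two_group_nontrivial_centralized[of p i s j])
      show "finite (rist ?u)" using fin by (simp add: rist_def)
      show "p ^^ (2 ^ i) = id" using p order by (simp add: rist_def)
      show "bij s" using rooted_tree_autD(1)[OF s(1)] .
      show "conj_by s p \<in> rist ?u" if "p \<in> rist ?u" for p
        using rist_conj_by[OF normal s(1) fixes_sibling[OF s(1) fixed k] that] .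
    qed (use p s in auto)
    interpret X: tree_permutation_group "rist (take k v)" by (rule rist_group)
    have sub: "rist ?u \<subseteq> rist (take k v)" "rist (take (Suc k) v) \<subseteq> rist (take k v)"
      using prefix_sibling(2)[OF k] by (auto intro: rist_mono[THEN subsetD])
    have "(\<lambda>z. c \<circ> z) ` Z (Suc k) \<subseteq> Z k"
    proof (rule image_subsetI)
      fix z assume z: "z \<in> Z (Suc k)"
      then have "c \<circ> z \<in> rist (take k v)"
        using X.comp_mem[of c z] c(1) sub by (auto simp: Z_def)
      moreover have "c \<circ> z \<circ> s = s \<circ> (c \<circ> z)"
        using z c(3) by (simp add: Z_def fun_eq_iff)
      ultimately show "c \<circ> z \<in> Z k" by (simp add: Z_def)
    qed
    moreover have "Z (Suc k) \<subseteq> Z k" using sub by (auto simp: Z_def)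
    ultimately have Un: "Z (Suc k) \<union> (\<lambda>z. c \<circ> z) ` Z (Suc k) \<subseteq> Z k" by simp
    obtain x where x: "c x \<noteq> x" using c(2) by (auto simp: fun_eq_iff)
    then have "x \<in> subtree ?u" using c(1) by (auto simp: rist_def)
    then have out: "x \<notin> subtree (take (Suc k) v)" using prefix_sibling(1)[OF k] by blast
    have disj: "Z (Suc k) \<inter> (\<lambda>z. c \<circ> z) ` Z (Suc k) = {}"
    proof -
      have "c \<circ> z \<notin> Z (Suc k)" if "z \<in> Z (Suc k)" for z
        using that out x by (auto simp: Z_def rist_def)
      then show ?thesis by blast
    qed
    have "inj_on (\<lambda>z. c \<circ> z) (Z (Suc k))"
      using Y.bij[OF c(1)] by (auto simp: inj_on_def fun_eq_iff) (metis bij_perm_inv(2))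
    then have "card (Z (Suc k) \<union> (\<lambda>z. c \<circ> z) ` Z (Suc k)) = 2 * card (Z (Suc k))"
      using disj finZ by (simp add: card_Un_disjoint card_image)
    then show ?thesis using card_mono[OF finZ Un] by simp
  qed
  have "2 ^ (length v - k) \<le> card (Z k)" if "k \<le> length v" for k
    using that
  proof (induction k rule: inc_induct)
    case base
    interpret X: tree_permutation_group "rist (take (length v) v)" by (rule rist_group)
    have "id \<in> Z (length v)" using X.id_mem by (simp add: Z_def)
    then have "card (Z (length v)) \<noteq> 0" using finZ by auto
    then show ?case by simp
  next
    case (step k)
    then have "(2::nat) ^ (length v - k) = 2 * 2 ^ (length v - Suc k)"
      by (metis Suc_diff_Suc power_Suc)
    also have "\<dots> \<le> card (Z k)" using step.IH doubling[OF step.hyps(2)] by linarith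
    finally show ?case .
  qed
  from this[of 0] show ?thesis
    by (simp add: Z_def rist_def subtree_def)
qed

lemma truncation_group: "tree_permutation_group (truncation m ` P)"
proof
  fix p q assume "p \<in> truncation m ` P"
  then obtain f where f: "f \<in> P" "p = truncation m f" by auto
  show "bij p" using f by (simp add: truncation_perm_inv tree_aut)
  show "rooted_tree_aut p" using f by (simp add: rooted_tree_aut_truncation tree_aut)
  show "perm_inv p \<in> truncation m ` P"
    using f by (simp add: truncation_perm_inv tree_aut inv_mem)
  assume "q \<in> truncation m ` P"
  then show "p \<circ> q \<in> truncation m ` P"
    using f by (auto simp: truncation_comp[symmetric] tree_aut intro: comp_mem)
next
  show "id \<in> truncation m ` P" using id_mem truncation_id by (metis imageI)
qed

end

locale branch_tree_group = tree_permutation_group \<Gamma> for \<Gamma> +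
  assumes transitive: "length v = length w \<Longrightarrow> \<exists>g\<in>\<Gamma>. g v = w"
    and branch: "\<exists>g\<in>\<Gamma>. g \<noteq> id \<and> (\<forall>w. w \<notin> subtree v \<longrightarrow> g w = w)"
begin

text \<open>
  The levels must be deep enough that in each of the \<open>length v\<close> sibling subtrees some rigid
  element is still nontrivial after truncation; then the bound on centralizers applies to the
  truncated group.
\<close>

lemma class_density_small:
  assumes s: "rooted_tree_aut s" and normal: "\<And>g. g \<in> \<Gamma> \<Longrightarrow> conj_by s g \<in> \<Gamma>" and fixed: "s v = v"
  shows "\<forall>\<^sub>F m in sequentially.
    2 ^ length v * card (truncation m ` (\<lambda>g. conj_by g s) ` \<Gamma>) \<le> card (truncation m ` \<Gamma>)"
proof -
  define sib where "sib k = take k v @ [\<not> v ! k]" for k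
  have "\<exists>g x. g \<in> \<Gamma> \<and> (\<forall>w. w \<notin> subtree (sib k) \<longrightarrow> g w = w) \<and> g x \<noteq> x" for k
    using branch[of "sib k"] by (auto simp: fun_eq_iff)
  then obtain g x where gx: "\<And>k. g k \<in> \<Gamma>" "\<And>k w. w \<notin> subtree (sib k) \<Longrightarrow> g k w = w"
      "\<And>k. g k (x k) \<noteq> x k"
    by metis
  have "\<forall>\<^sub>F m in sequentially. \<forall>k\<in>{..<length v}. length (x k) \<le> m"
    by (intro eventually_ball_finite finite_lessThan ballI eventually_ge_at_top)
  moreover have "\<forall>\<^sub>F m in sequentially. length v \<le> m" by (rule eventually_ge_at_top)
  ultimately show ?thesis
  proof eventually_elim
    case (elim m)
    interpret P: tree_permutation_group "truncation m ` \<Gamma>" by (rule truncation_group)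
    let ?s = "truncation m s"
    have fin: "finite (truncation m ` \<Gamma>)" by (rule finite_truncations) (rule tree_aut)
    have cls: "truncation m ` (\<lambda>g. conj_by g s) ` \<Gamma> = (\<lambda>p. conj_by p ?s) ` truncation m ` \<Gamma>"
      by (simp add: image_image truncation_conj_by s tree_aut)
    have "2 ^ length v \<le> card {z \<in> truncation m ` \<Gamma>. z \<circ> ?s = ?s \<circ> z}"
    proof (rule P.card_centralizer_ge[OF fin, of m ?s m])
      fix p assume "p \<in> truncation m ` \<Gamma>"
      then obtain f where f: "f \<in> \<Gamma>" "p = truncation m f" by auto
      show "p ^^ (2 ^ m) = id" using f by (simp add: truncation_order tree_aut)
      show "conj_by ?s p \<in> truncation m ` \<Gamma>"
        using f normal by (simp add: truncation_conj_by[symmetric] s tree_aut)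
    next
      show "rooted_tree_aut ?s" by (rule rooted_tree_aut_truncation[OF s])
      show "?s ^^ (2 ^ m) = id" by (rule truncation_order[OF s])
      show "?s v = v" using elim fixed by (simp add: truncation_apply)
      fix k assume "k < length v"
      then have len: "length (x k) \<le> m" using elim by simp
      have "truncation m (g k) \<in> P.rist (sib k)"
        using gx truncation_supported[of "sib k" "g k"] by (simp add: P.rist_def)
      moreover have "truncation m (g k) \<noteq> id"
        using truncation_apply[OF len, of "g k"] gx(3)[of k] by (metis id_apply)
      ultimately show "P.rist (take k v @ [\<not> v ! k]) \<noteq> {id}" unfolding sib_def by auto
    qed
    then show ?case
      using P.card_class_centralizer[OF fin, of ?s] unfolding cls
      by (metis (no_types, lifting) le_trans mult.commute mult_le_mono1)
  qed
qed

text \<open>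
  The densities of the classes are compared with the density of the set \<open>Q\<close> of elements fixing one
  chosen vertex of level \<open>N\<close>. In every truncation the coset is covered by \<open>2 ^ N\<close> translates of \<open>Q\<close>,
  while \<open>Q\<close> is covered by the classes in \<open>B\<close>, whose total density tends to zero.
\<close>

theorem infinite_conj_classes_coset:
  assumes t: "rooted_tree_aut t" and normal: "\<And>g. g \<in> \<Gamma> \<Longrightarrow> conj_by t g \<in> \<Gamma>"
  shows "infinite ((\<lambda>s. (\<lambda>g. conj_by g s) ` \<Gamma>) ` (\<lambda>g. g \<circ> t) ` \<Gamma>)"
proof
  define X where "X = (\<lambda>g. g \<circ> t) ` \<Gamma>"
  define cls where "cls s = (\<lambda>g. conj_by g s) ` \<Gamma>" for s
  assume "finite ((\<lambda>s. (\<lambda>g. conj_by g s) ` \<Gamma>) ` (\<lambda>g. g \<circ> t) ` \<Gamma>)"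
  then have finite_cls: "finite (cls ` X)" by (simp add: X_def cls_def)
  have X_aut: "rooted_tree_aut s" if "s \<in> X" for s
    using that by (auto simp: X_def intro: rooted_tree_aut_comp tree_aut t)
  have X_normal: "conj_by s g \<in> \<Gamma>" if s: "s \<in> X" and g: "g \<in> \<Gamma>" for s g
  proof -
    obtain f where f: "f \<in> \<Gamma>" "s = f \<circ> t" using s by (auto simp: X_def)
    have "conj_by s g = f \<circ> conj_by t g \<circ> perm_inv f"
      using f rooted_tree_autD(1)[OF t] by (simp add: conj_by_comp bij) (simp add: conj_by_def)
    then show ?thesis using f g by (simp add: comp_mem inv_mem normal)
  qed
  have X_closed: "conj_by g s \<in> X" if s: "s \<in> X" and g: "g \<in> \<Gamma>" for s g
  proof -
    obtain f where f: "f \<in> \<Gamma>" "s = f \<circ> t" using s by (auto simp: X_def)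
    have "conj_by g s = (g \<circ> f \<circ> conj_by t (perm_inv g)) \<circ> t"
      using rooted_tree_autD(1)[OF t] f by (simp add: conj_by_def fun_eq_iff bij_perm_inv)
    then show ?thesis using f g by (auto simp: X_def intro!: comp_mem inv_mem normal)
  qed
  have cls_eq: "cls s' = cls s" if s': "s' \<in> cls s" for s s'
  proof -
    obtain g where "g \<in> \<Gamma>" "s' = conj_by g s" using s' by (auto simp: cls_def)
    then show ?thesis by (simp add: cls_def conj_class_eq)
  qed
  have mem_cls: "s \<in> cls s" for s
    unfolding cls_def using id_mem conj_by_id by (metis imageI)
  define fixes_at where "fixes_at n s \<longleftrightarrow> (\<exists>v. length v = n \<and> s v = v)" for n and s :: "vertex \<Rightarrow> vertex"
  \<comment> \<open>The classes whose density tends to zero.\<close>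
  define B where "B = {C \<in> cls ` X. \<forall>n. \<exists>s\<in>C. fixes_at n s}"
  have finB: "finite B" using finite_cls by (simp add: B_def)
  have "\<forall>\<^sub>F n in sequentially. \<forall>C\<in>cls ` X - B. \<forall>s\<in>C. \<not> fixes_at n s"
  proof (rule eventually_ball_finite)
    show "\<forall>C\<in>cls ` X - B. \<forall>\<^sub>F n in sequentially. \<forall>s\<in>C. \<not> fixes_at n s"
    proof
      fix C assume "C \<in> cls ` X - B"
      then obtain n x where n: "\<forall>s\<in>C. \<not> fixes_at n s" and x: "x \<in> X" "C = cls x"
        by (auto simp: B_def)
      have "\<not> fixes_at k s" if "s \<in> C" "n \<le> k" for s k
      proof
        assume "fixes_at k s"
        then obtain v where "length v = k" "s v = v" by (auto simp: fixes_at_def)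
        moreover have "rooted_tree_aut s" using that x X_closed X_aut by (auto simp: cls_def)
        ultimately have "fixes_at n s"
          unfolding fixes_at_def using rooted_tree_autD(3)[of s n v] \<open>n \<le> k\<close>
          by (intro exI[of _ "take n v"]) simp
        then show False using n that by blast
      qed
      then show "\<forall>\<^sub>F n in sequentially. \<forall>s\<in>C. \<not> fixes_at n s"
        unfolding eventually_sequentially by blast
    qed
  qed (use finite_cls in simp)
  then obtain N where N: "\<forall>C\<in>cls ` X - B. \<forall>s\<in>C. \<not> fixes_at N s"
    by (auto simp: eventually_sequentially)
  define v where "v = replicate N True"
  define Q where "Q = {s \<in> X. s v = v}"
  have QB: "Q \<subseteq> \<Union> B"
  proof
    fix s assume s: "s \<in> Q"
    then have "fixes_at N s" unfolding fixes_at_def by (intro exI[of _ v]) (simp add: Q_def v_def)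
    then have "cls s \<in> B" using N s mem_cls by (auto simp: Q_def)
    then show "s \<in> \<Union> B" using mem_cls by blast
  qed
  \<comment> \<open>Chosen so that \<open>card B\<close> classes of density at most \<open>2\<^sup>-\<^sup>n\<close> are too few to cover a set of
    density \<open>2\<^sup>-\<^sup>N\<close>.\<close>
  define n where "n = N + card B"
  have "\<forall>\<^sub>F m in sequentially. \<forall>C\<in>B. 2 ^ n * card (truncation m ` C) \<le> card (truncation m ` \<Gamma>)"
  proof (rule eventually_ball_finite[OF finB], rule ballI)
    fix C assume C: "C \<in> B"
    then obtain x where x: "x \<in> X" "C = cls x" by (auto simp: B_def)
    obtain s w where s: "s \<in> C" "length w = n" "s w = w"
      using C unfolding B_def fixes_at_def by blast
    have C_eq: "C = cls s" using cls_eq s x by blast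
    have "s \<in> X" using s x X_closed by (auto simp: cls_def)
    from class_density_small[OF X_aut[OF this] X_normal[OF this] s(3)] s(2)
    show "\<forall>\<^sub>F m in sequentially. 2 ^ n * card (truncation m ` C) \<le> card (truncation m ` \<Gamma>)"
      unfolding C_eq cls_def by simp
  qed
  then obtain m where m: "\<forall>C\<in>B. 2 ^ n * card (truncation m ` C) \<le> card (truncation m ` \<Gamma>)"
    by (auto simp: eventually_sequentially)
  have fin: "finite (truncation m ` A)" if "A \<subseteq> X \<or> A \<subseteq> \<Gamma>" for A
    using that X_aut tree_aut by (intro finite_truncations) auto
  have "card (truncation m ` \<Gamma>) = card ((\<lambda>p. p \<circ> truncation m t) ` truncation m ` \<Gamma>)"
  proof (rule card_image[symmetric])
    have "bij (truncation m t)" by (rule truncation_perm_inv(2)[OF t])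
    then show "inj_on (\<lambda>p. p \<circ> truncation m t) (truncation m ` \<Gamma>)"
      by (intro inj_onI) (metis bij_is_surj surj_fun_eq comp_apply)
  qed
  also have "\<dots> = card (truncation m ` X)"
    by (simp add: X_def image_image truncation_comp t)
  also have "\<dots> \<le> 2 ^ N * card (truncation m ` Q)"
  proof -
    define k where "k u = (SOME g. g \<in> \<Gamma> \<and> g v = u)" for u
    have k: "k u \<in> \<Gamma> \<and> k u v = u" if "u \<in> level N" for u
    proof -
      have "\<exists>g. g \<in> \<Gamma> \<and> g v = u" using transitive[of v u] that by (auto simp: v_def level_def)
      then show ?thesis unfolding k_def by (rule someI_ex)
    qed
    have lev: "finite (level N)" "card (level N) = 2 ^ N"
      using finite_lists_length_eq[of "UNIV :: bool set" N] card_lists_length_eq[of "UNIV :: bool set" N]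
      by (simp_all add: level_def)
    have "truncation m ` X \<subseteq> (\<Union>u\<in>level N. (\<lambda>q. truncation m (k u) \<circ> q) ` truncation m ` Q)"
    proof (rule image_subsetI)
      fix s assume s: "s \<in> X"
      define u where "u = s v"
      have u: "u \<in> level N" using rooted_tree_autD(2)[OF X_aut[OF s]] by (simp add: u_def level_def v_def)
      define q where "q = perm_inv (k u) \<circ> s"
      have bk: "bij (k u)" using k[OF u] bij by blast
      obtain f where f: "f \<in> \<Gamma>" "s = f \<circ> t" using s by (auto simp: X_def)
      have "q = (perm_inv (k u) \<circ> f) \<circ> t" by (simp add: q_def f comp_assoc)
      then have qX: "q \<in> X" using f k[OF u] by (auto simp: X_def intro!: comp_mem inv_mem)
      moreover have "q v = v" using k[OF u] bij_perm_inv(2)[OF bk, of v] by (simp add: q_def u_def)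
      ultimately have "q \<in> Q" by (simp add: Q_def)
      moreover have "s = k u \<circ> q" using bk by (simp add: q_def fun_eq_iff bij_perm_inv)
      then have "truncation m s = truncation m (k u) \<circ> truncation m q"
        by (simp add: truncation_comp X_aut[OF qX])
      ultimately show "truncation m s \<in> (\<Union>u\<in>level N. (\<lambda>q. truncation m (k u) \<circ> q) ` truncation m ` Q)"
        using u by blast
    qed
    then have "card (truncation m ` X) \<le> card (\<Union>u\<in>level N. (\<lambda>q. truncation m (k u) \<circ> q) ` truncation m ` Q)"
      by (rule card_mono[rotated]) (use lev fin[of Q] in \<open>auto simp: Q_def\<close>)
    also have "\<dots> \<le> (\<Sum>u\<in>level N. card ((\<lambda>q. truncation m (k u) \<circ> q) ` truncation m ` Q))"
      by (rule card_UN_le[OF lev(1)])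
    also have "\<dots> \<le> (\<Sum>u\<in>level N. card (truncation m ` Q))"
      by (intro sum_mono card_image_le fin) (auto simp: Q_def)
    also have "\<dots> = 2 ^ N * card (truncation m ` Q)" by (simp add: lev)
    finally show ?thesis .
  qed
  finally have lower: "card (truncation m ` \<Gamma>) \<le> 2 ^ N * card (truncation m ` Q)" .
  have "card (truncation m ` Q) \<le> card (\<Union>C\<in>B. truncation m ` C)"
  proof (rule card_mono)
    have "C \<subseteq> X" if "C \<in> B" for C using that X_closed by (auto simp: B_def cls_def)
    then show "finite (\<Union>C\<in>B. truncation m ` C)" using finB fin by blast
  qed (use QB in auto)
  also have "\<dots> \<le> (\<Sum>C\<in>B. card (truncation m ` C))" by (rule card_UN_le[OF finB])
  finally have "2 ^ n * card (truncation m ` Q) \<le> (\<Sum>C\<in>B. 2 ^ n * card (truncation m ` C))"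
    by (simp add: sum_distrib_left[symmetric])
  also have "\<dots> \<le> (\<Sum>C\<in>B. card (truncation m ` \<Gamma>))" by (rule sum_mono) (use m in blast)
  finally have upper: "2 ^ n * card (truncation m ` Q) \<le> card B * card (truncation m ` \<Gamma>)" by simp
  have "card (truncation m ` \<Gamma>) \<noteq> 0" using fin[of \<Gamma>] id_mem by auto
  then have pos: "card (truncation m ` Q) \<noteq> 0" using lower by (metis le_zero_eq mult_0_right)
  have "2 ^ n * card (truncation m ` Q) \<le> card B * (2 ^ N * card (truncation m ` Q))"
    using upper lower by (meson le_trans mult_le_mono2)
  then have "2 ^ card B \<le> card B" using pos by (simp add: n_def power_add mult.assoc mult.left_commute)
  then show False using less_exp[of "card B"] by simp
qed

end

section \<open>Rigid stabilizers in tree groups\<close>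

context tree_group
begin

lemma group_G: "group G"
  using group_hom by (rule group_hom.axioms(1))

sublocale G: group G by (rule group_G)

lemma act_mult: "g \<in> carrier G \<Longrightarrow> h \<in> carrier G \<Longrightarrow> \<alpha> (g \<otimes> h) w = \<alpha> g (\<alpha> h w)"
  by (rule composition_rule) auto

lemma act_one: "\<alpha> \<one> = id"
  using id_eq_one by (simp add: fun_eq_iff restrict_def)

lemma act_inv: "g \<in> carrier G \<Longrightarrow> \<alpha> (inv g) (\<alpha> g w) = w" "g \<in> carrier G \<Longrightarrow> \<alpha> g (\<alpha> (inv g) w) = w"
  using act_mult[of "inv g" g w] act_mult[of g "inv g" w] by (simp_all add: act_one)

lemma act_eqI: "g \<in> carrier G \<Longrightarrow> h \<in> carrier G \<Longrightarrow> (\<And>w. \<alpha> g w = \<alpha> h w) \<Longrightarrow> g = h"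
  by (rule inj_onD[OF faithful]) auto

lemma act_inv_eq: "g \<in> carrier G \<Longrightarrow> \<alpha> (inv g) = perm_inv (\<alpha> g)"
  by (rule inv_equality[symmetric]) (simp_all add: act_inv)

lemmas act_length = rooted_tree_autD(2)[OF tree_aut]
lemmas act_eq_iff = rooted_tree_autD(4)[OF tree_aut]
lemmas act_subtree = rooted_tree_autD(5)[OF tree_aut]

definition rist :: "vertex \<Rightarrow> 'a set" where
  "rist v = {g \<in> carrier G. \<forall>w. w \<notin> subtree v \<longrightarrow> \<alpha> g w = w}"

lemma rist_carrier: "g \<in> rist v \<Longrightarrow> g \<in> carrier G"
  by (simp add: rist_def)

lemma rist_mult: "g \<in> rist v \<Longrightarrow> h \<in> rist v \<Longrightarrow> g \<otimes> h \<in> rist v"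
  by (simp add: rist_def act_mult)

lemma rist_inv: "g \<in> rist v \<Longrightarrow> inv g \<in> rist v"
  by (auto simp: rist_def) (metis act_inv(1))

lemma rist_mono: "subtree u \<subseteq> subtree v \<Longrightarrow> rist u \<subseteq> rist v"
  by (auto simp: rist_def)

lemma rist_conj:
  assumes g: "g \<in> carrier G" and r: "r \<in> rist v"
  shows "g \<otimes> r \<otimes> inv g \<in> rist (\<alpha> g v)"
proof -
  have "\<alpha> (g \<otimes> r \<otimes> inv g) w = w" if "w \<notin> subtree (\<alpha> g v)" for w
  proof -
    have "\<alpha> (inv g) w \<notin> subtree v"
      using that act_subtree[OF g, of "\<alpha> (inv g) w" v] g by (simp add: act_inv)
    then show ?thesis using r g by (simp add: rist_def act_mult act_inv)
  qed
  then show ?thesis using g r by (simp add: rist_def)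
qed

lemma rist_disjoint_eq_one:
  assumes "length u = length v" "u \<noteq> v" "g \<in> rist u" "g \<in> rist v"
  shows "g = \<one>"
proof (rule act_eqI)
  fix w
  have "\<alpha> g w = w" using assms(3,4) disjoint_subtrees[OF assms(1,2), of w] by (auto simp: rist_def)
  then show "\<alpha> g w = \<alpha> \<one> w" by (simp add: act_one)
qed (use assms(3) in \<open>simp_all add: rist_carrier\<close>)

lemma rist_disjoint_commute:
  assumes uv: "length u = length v" "u \<noteq> v" and g: "g \<in> rist u" and h: "h \<in> rist v"
  shows "g \<otimes> h = h \<otimes> g"
proof (rule act_eqI)
  have c: "g \<in> carrier G" "h \<in> carrier G" using g h by (simp_all add: rist_carrier)
  then show "g \<otimes> h \<in> carrier G" "h \<otimes> g \<in> carrier G" by simp_all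
  fix w
  have gw: "\<alpha> g x = x" if "x \<notin> subtree u" for x using g that by (simp add: rist_def)
  have hw: "\<alpha> h x = x" if "x \<notin> subtree v" for x using h that by (simp add: rist_def)
  have gs: "\<alpha> g x \<in> subtree u \<longleftrightarrow> x \<in> subtree u" for x
    using gw c(1) by (metis act_eq_iff)
  have hs: "\<alpha> h x \<in> subtree v \<longleftrightarrow> x \<in> subtree v" for x
    using hw c(2) by (metis act_eq_iff)
  have dis: "x \<notin> subtree u \<or> x \<notin> subtree v" for x
    using disjoint_subtrees[OF uv] by blast
  show "\<alpha> (g \<otimes> h) w = \<alpha> (h \<otimes> g) w"
    unfolding act_mult[OF c] act_mult[OF c(2) c(1)] using gw hw gs hs dis by metis
qed

text \<open>
  For the image of a rigid stabilizer the vertices touched on its level are the candidates for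
  the image of the vertex under the tree automorphism to be built. Elements of \<open>A\<close> are allowed to move
  \<open>u\<close> itself.
\<close>

definition touches :: "'a set \<Rightarrow> vertex \<Rightarrow> bool" where
  "touches A u \<longleftrightarrow> (\<exists>a\<in>A. \<exists>w\<in>subtree u. \<alpha> a w \<noteq> w)"

end

context weakly_branch_group
begin

lemma rist_nontrivial:
  obtains g w where "g \<in> rist v" "w \<in> subtree v" "\<alpha> g w \<noteq> w"
  using weakly_branch[of v] unfolding rist_def by blast

text \<open>
  The set \<open>L\<close> stands for a subgroup of finite index, given through a map \<open>\<kappa>\<close> with finitely many
  values that separates its left cosets. Below \<open>w\<close> there is an infinite family of vertices with
  disjoint subtrees, hence infinitely many independent rigid elements, and two of them lie in the same
  left coset of \<open>L\<close>.
\<close>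

lemma finite_index_meets_rist:
  assumes fin: "finite (\<kappa> ` carrier G)"
    and L: "\<And>g h. g \<in> carrier G \<Longrightarrow> h \<in> carrier G \<Longrightarrow> \<kappa> g = \<kappa> h \<Longrightarrow> inv g \<otimes> h \<in> L"
  obtains r where "r \<in> rist w" "r \<in> L" "r \<noteq> \<one>"
proof -
  \<comment> \<open>The vertices hanging off the ray \<open>w, w1, w11, \<dots>\<close>; their subtrees are disjoint.\<close>
  define u where "u i = w @ replicate i True @ [False]" for i
  have sub: "subtree (u i) \<subseteq> subtree w" for i by (auto simp: u_def subtree_def)
  have disj: "subtree (u i) \<inter> subtree (u j) = {}" if "i \<noteq> j" for i j
  proof -
    have "x \<notin> subtree (u j)" if x: "x \<in> subtree (u i)" and ij: "i < j" for x i j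
    proof
      assume xj: "x \<in> subtree (u j)"
      have "x ! (length w + i) = u i ! (length w + i)"
        using x by (auto simp: subtree_def u_def nth_append)
      moreover have "x ! (length w + i) = u j ! (length w + i)"
        using xj ij by (auto simp: subtree_def u_def nth_append)
      ultimately show False using ij by (simp add: u_def nth_append)
    qed
    then show ?thesis using that by (metis disjoint_iff linorder_neqE_nat)
  qed
  have "\<exists>g x. g \<in> rist (u i) \<and> x \<in> subtree (u i) \<and> \<alpha> g x \<noteq> x" for i
    using rist_nontrivial[of "u i"] by metis
  then obtain g x where gx: "\<And>i. g i \<in> rist (u i)" "\<And>i. x i \<in> subtree (u i)" "\<And>i. \<alpha> (g i) (x i) \<noteq> x i"
    by metis
  have c: "g i \<in> carrier G" for i using gx(1) by (rule rist_carrier)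
  have "\<not> inj (\<lambda>i. \<kappa> (g i))"
    using finite_imageD[of "\<lambda>i. \<kappa> (g i)" UNIV] fin c
    by (metis finite_subset image_image image_mono infinite_UNIV_nat image_subset_iff)
  then obtain i j where ij: "i \<noteq> j" "\<kappa> (g i) = \<kappa> (g j)" by (auto simp: inj_def)
  show ?thesis
  proof
    show "inv (g i) \<otimes> g j \<in> rist w"
      using gx(1) rist_mono[OF sub] by (meson rist_inv rist_mult subsetD)
    show "inv (g i) \<otimes> g j \<in> L" using L c ij(2) by blast
    show "inv (g i) \<otimes> g j \<noteq> \<one>"
    proof
      assume "inv (g i) \<otimes> g j = \<one>"
      then have "g j = g i" using c by (metis G.inv_solve_left' G.r_one G.one_closed)
      moreover have "x i \<notin> subtree (u j)" using disj[OF ij(1)] gx(2) by blast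
      ultimately show False using gx(1)[of j] gx(3)[of i] by (simp add: rist_def)
    qed
  qed
qed

text \<open>
  An element moving \<open>y\<close> conjugates the rigid stabilizer of \<open>y\<close> to that of another vertex, so it
  cannot commute with nontrivial elements of it.
\<close>

lemma finite_index_rist_nonabelian:
  assumes fin: "finite (\<kappa> ` carrier G)"
    and L: "\<And>g h. g \<in> carrier G \<Longrightarrow> h \<in> carrier G \<Longrightarrow> \<kappa> g = \<kappa> h \<Longrightarrow> inv g \<otimes> h \<in> L"
  obtains r r' where "r \<in> rist w" "r \<in> L" "r' \<in> rist w" "r' \<in> L" "r \<otimes> r' \<noteq> r' \<otimes> r"
proof -
  obtain r where r: "r \<in> rist w" "r \<in> L" "r \<noteq> \<one>" using finite_index_meets_rist[OF assms] .
  have c: "r \<in> carrier G" using r(1) by (rule rist_carrier)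
  then obtain y where y: "\<alpha> r y \<noteq> y" using r(3) act_eqI[of r \<one>] by (auto simp: act_one)
  then have "y \<in> subtree w" using r(1) by (auto simp: rist_def)
  then have sub: "subtree y \<subseteq> subtree w" by (auto simp: subtree_def)
  obtain z where z: "z \<in> rist y" "z \<in> L" "z \<noteq> \<one>" using finite_index_meets_rist[OF assms] .
  have cz: "z \<in> carrier G" using z(1) by (rule rist_carrier)
  have "r \<otimes> z \<noteq> z \<otimes> r"
  proof
    assume "r \<otimes> z = z \<otimes> r"
    then have "r \<otimes> z \<otimes> inv r = z" using c cz by (simp add: G.m_assoc)
    then have "z \<in> rist (\<alpha> r y)" using rist_conj[OF c z(1)] by simp
    then show False using rist_disjoint_eq_one[of "\<alpha> r y" y z] y z act_length[OF c] by simp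
  qed
  then show ?thesis using that r z rist_mono[OF sub] by blast
qed

end

section \<open>Automorphisms of saturated weakly branch groups come from the tree\<close>

context saturated_weakly_branch_group
begin

context
  fixes \<phi> assumes phi: "\<phi> \<in> iso G G"
begin

lemma phi_hom: "\<phi> \<in> hom G G" using phi by (simp add: iso_def)

interpretation phi: group_hom G G \<phi>
  using phi_hom by (simp add: group_hom_def group_hom_axioms_def group_G)

lemma phi_inj: "g \<in> carrier G \<Longrightarrow> h \<in> carrier G \<Longrightarrow> \<phi> g = \<phi> h \<longleftrightarrow> g = h"
  using phi by (auto simp: iso_def bij_betw_def inj_on_def)

lemma phi_surj: "g \<in> carrier G \<Longrightarrow> \<exists>h\<in>carrier G. \<phi> h = g"
  using phi by (force simp: iso_def bij_betw_def)

lemma phi_rist_carrier: "a \<in> \<phi> ` rist v \<Longrightarrow> a \<in> carrier G"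
  using rist_carrier by auto

lemma phi_rist_mult:
  assumes "a \<in> \<phi> ` rist v" "b \<in> \<phi> ` rist v"
  shows "a \<otimes> b \<in> \<phi> ` rist v"
proof -
  obtain r s where rs: "r \<in> rist v" "s \<in> rist v" "a = \<phi> r" "b = \<phi> s" using assms by blast
  then have "a \<otimes> b = \<phi> (r \<otimes> s)" by (simp add: rist_carrier)
  then show ?thesis using rs rist_mult by blast
qed

lemma phi_rist_inv:
  assumes "a \<in> \<phi> ` rist v"
  shows "inv a \<in> \<phi> ` rist v"
proof -
  obtain r where r: "r \<in> rist v" "a = \<phi> r" using assms by blast
  then have "inv a = \<phi> (inv r)" by (simp add: rist_carrier)
  then show ?thesis using r rist_inv by blast
qed

lemma phi_rist_conj:
  assumes l: "l \<in> carrier G" and a: "a \<in> \<phi> ` rist v"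
  shows "\<phi> l \<otimes> a \<otimes> inv (\<phi> l) \<in> \<phi> ` rist (\<alpha> l v)"
proof -
  obtain r where r: "r \<in> rist v" "a = \<phi> r" using a by auto
  then have "\<phi> l \<otimes> a \<otimes> inv (\<phi> l) = \<phi> (l \<otimes> r \<otimes> inv l)" using l by (simp add: rist_carrier)
  then show ?thesis using rist_conj[OF l r(1)] by simp
qed

text \<open>
  The characteristic subgroup \<open>H\<close> for the level of \<open>v\<close> equals its image under \<open>\<phi>\<close> and fixes \<open>v\<close>,
  so it normalizes the image of the rigid stabilizer of \<open>v\<close>. As \<open>H\<close> acts transitively on the levels of
  the subtree of \<open>u\<close>, one moved vertex there forces all vertices on its level, and hence all below
  them, to be moved by some element.
\<close>

lemma touches_phi_rist_all:
  assumes u: "length u = length v" and touch: "touches (\<phi> ` rist v) u"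
  shows "\<exists>k. \<forall>w \<in> subtree u. length w \<ge> k \<longrightarrow> (\<exists>a \<in> \<phi> ` rist v. \<alpha> a w \<noteq> w)"
proof -
  obtain a x where a: "a \<in> \<phi> ` rist v" and x: "x \<in> subtree u" "\<alpha> a x \<noteq> x"
    using touch by (auto simp: touches_def)
  obtain H where H: "characteristic_subgroup H G" "\<forall>h \<in> H. \<forall>v \<in> level (length v). \<alpha> h v = v"
      and trans: "\<forall>v \<in> level (length v). \<forall>k. \<forall>x \<in> subtree_level v k. \<forall>y \<in> subtree_level v k. \<exists>h \<in> H. \<alpha> h x = y"
    using saturated[of "length v"] by blast
  have Hphi: "\<phi> ` H = H" and Hsub: "H \<subseteq> carrier G"
    using H(1) phi by (simp_all add: characteristic_subgroup_def subgroup.subset)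
  have len: "length x \<ge> length u" using x(1) by (auto simp: subtree_def)
  show ?thesis
  proof (intro exI[of _ "length x"] ballI impI)
    fix w assume w: "w \<in> subtree u" "length w \<ge> length x"
    define y where "y = take (length x) w"
    have y: "y \<in> subtree_level u (length x - length u)" "x \<in> subtree_level u (length x - length u)"
      using w x(1) len by (auto simp: y_def subtree_level_def subtree_iff)
    then obtain h where h: "h \<in> H" "\<alpha> h x = y" using trans u by (force simp: level_def)
    then obtain l where l: "l \<in> H" "h = \<phi> l" using Hphi by blast
    have c: "l \<in> carrier G" "h \<in> carrier G" "a \<in> carrier G" using l h Hsub a phi_rist_carrier by auto
    let ?b = "h \<otimes> a \<otimes> inv h"
    have b: "?b \<in> \<phi> ` rist v" using phi_rist_conj[OF c(1) a] l H(2) by (auto simp: level_def)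
    have "\<alpha> ?b y = \<alpha> h (\<alpha> a x)" using c h(2) by (auto simp: act_mult act_inv)
    then have "\<alpha> ?b y \<noteq> y" using x(2) h(2) act_eq_iff[OF c(2)] by metis
    then have "\<alpha> ?b w \<noteq> w"
      unfolding y_def using rooted_tree_autD(3)[OF tree_aut] b phi_rist_carrier by metis
    then show "\<exists>a \<in> \<phi> ` rist v. \<alpha> a w \<noteq> w" using b by blast
  qed
qed

text \<open>
  Suppose the image \<open>A\<close> of the rigid stabilizer of \<open>v\<close> and the image \<open>B\<close> of that of \<open>v'\<close> both touch
  \<open>u\<close>. Then some \<open>w\<close> below \<open>u\<close> is moved by an \<open>a \<in> A\<close> and by a \<open>b \<in> B\<close>, and \<open>A\<close> commutes with \<open>B\<close>.
  The group \<open>A\<close> is normalized by a subgroup \<open>L\<close> of finite index, so for \<open>r\<close> and \<open>r'\<close> in \<open>L\<close> the double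
  commutator \<open>[[a, r], r']\<close> lies in \<open>A\<close>. If \<open>r\<close> and \<open>r'\<close> are rigid at \<open>w\<close> as well, then, as \<open>a\<close>
  displaces the subtree of \<open>w\<close>, the double commutator is \<open>[r\<inverse>, r']\<close>. It is nontrivial for
  suitable \<open>r\<close> and \<open>r'\<close>, rigid at \<open>w\<close>, and commutes with \<open>b\<close>, although \<open>b\<close> displaces the subtree
  of \<open>w\<close>. That is impossible.
\<close>

lemma not_both_touch:
  assumes len: "length v = length v'" "length u = length v" and neq: "v \<noteq> v'"
    and touch: "touches (\<phi> ` rist v) u" "touches (\<phi> ` rist v') u"
  shows False
proof -
  obtain k k' where k: "\<forall>w \<in> subtree u. length w \<ge> k \<longrightarrow> (\<exists>a \<in> \<phi> ` rist v. \<alpha> a w \<noteq> w)"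
      and k': "\<forall>w \<in> subtree u. length w \<ge> k' \<longrightarrow> (\<exists>b \<in> \<phi> ` rist v'. \<alpha> b w \<noteq> w)"
    using touches_phi_rist_all[of u v] touches_phi_rist_all[of u v'] len touch by auto
  define w where "w = u @ replicate (max k k') True"
  have "w \<in> subtree u" "length w \<ge> k" "length w \<ge> k'" by (auto simp: w_def subtree_def)
  then obtain a b where a: "a \<in> \<phi> ` rist v" "\<alpha> a w \<noteq> w" and b: "b \<in> \<phi> ` rist v'" "\<alpha> b w \<noteq> w"
    using k k' by blast
  define n where "n = length v"
  \<comment> \<open>The image of the stabilizer of level \<open>n\<close>; it has finite index and normalizes every image of
    a rigid stabilizer of a vertex of that level.\<close>
  define L where "L = {\<phi> l |l. l \<in> carrier G \<and> (\<forall>x. length x = n \<longrightarrow> \<alpha> l x = x)}"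
  define \<psi> where "\<psi> = inv_into (carrier G) \<phi>"
  have psi: "\<psi> g \<in> carrier G" "\<phi> (\<psi> g) = g" if "g \<in> carrier G" for g
    using phi_surj[OF that] by (auto simp: \<psi>_def intro!: inv_into_into f_inv_into_f)
  have fin: "finite ((\<lambda>g. truncation n (\<alpha> (\<psi> g))) ` carrier G)"
    using finite_truncations[of "(\<lambda>g. \<alpha> (\<psi> g)) ` carrier G" n] psi(1) tree_aut by (auto simp: image_image)
  have coset: "inv g \<otimes> h \<in> L"
    if g: "g \<in> carrier G" and h: "h \<in> carrier G" and eq: "truncation n (\<alpha> (\<psi> g)) = truncation n (\<alpha> (\<psi> h))" for g h
  proof -
    have "\<alpha> (inv (\<psi> g) \<otimes> \<psi> h) x = x" if "length x = n" for x
    proof -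
      have "\<alpha> (\<psi> h) x = \<alpha> (\<psi> g) x"
        using truncation_apply[of x n] that eq by (metis order_refl)
      then show ?thesis using psi g h by (simp add: act_mult act_inv)
    qed
    moreover have "inv g \<otimes> h = \<phi> (inv (\<psi> g) \<otimes> \<psi> h)" using psi g h by simp
    ultimately show ?thesis unfolding L_def using psi g h by (intro CollectI exI[of _ "inv (\<psi> g) \<otimes> \<psi> h"]) simp
  qed
  have norm: "l \<otimes> x \<otimes> inv l \<in> \<phi> ` rist v" if "l \<in> L" "x \<in> \<phi> ` rist v" for l x
    using that phi_rist_conj[of _ x v] by (force simp: L_def n_def)
  obtain r r' where r: "r \<in> rist w" "r \<in> L" and r': "r' \<in> rist w" "r' \<in> L"
      and noncomm: "r \<otimes> r' \<noteq> r' \<otimes> r"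
    using finite_index_rist_nonabelian[OF fin coset] by blast
  have car [simp]: "a \<in> carrier G" "b \<in> carrier G" "r \<in> carrier G" "r' \<in> carrier G"
    using a b r r' by (auto simp: phi_rist_carrier rist_carrier)
  \<comment> \<open>With these, \<open>c = [a, r]\<close> and \<open>d = [[a, r], r']\<close>; as \<open>q\<close> is rigid at \<open>\<alpha> a w\<close>, it cancels from \<open>d\<close>.\<close>
  define q where "q = a \<otimes> r \<otimes> inv a"
  define x where "x = inv r \<otimes> r' \<otimes> r"
  define c where "c = q \<otimes> inv r"
  define d where "d = c \<otimes> (r' \<otimes> inv c \<otimes> inv r')"
  have q: "q \<in> rist (\<alpha> a w)" unfolding q_def by (rule rist_conj[OF car(1) r(1)])
  have x: "x \<in> rist w" unfolding x_def using r r' by (intro rist_mult rist_inv)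
  have car' [simp]: "q \<in> carrier G" "x \<in> carrier G" using q x by (auto simp: rist_carrier)
  have "c = a \<otimes> (r \<otimes> inv a \<otimes> inv r)" by (simp add: c_def q_def G.m_assoc)
  then have cA: "c \<in> \<phi> ` rist v" using a r norm by (simp add: phi_rist_mult phi_rist_inv)
  then have dA: "d \<in> \<phi> ` rist v" using r' norm by (simp add: d_def phi_rist_mult phi_rist_inv)
  have "d = q \<otimes> x \<otimes> inv q \<otimes> inv r'"
    by (simp add: d_def c_def x_def G.m_assoc G.inv_mult_group)
  also have "q \<otimes> x = x \<otimes> q"
    using rist_disjoint_commute[OF _ _ q x] a(2) by (simp add: act_length)
  finally have d: "d = x \<otimes> inv r'" by (simp add: G.m_assoc)
  then have dw: "d \<in> rist w" using x r' by (simp add: rist_mult rist_inv)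
  have card: "d \<in> carrier G" using dw by (rule rist_carrier)
  obtain f g where fg: "f \<in> rist v" "g \<in> rist v'" "d = \<phi> f" "b = \<phi> g" using dA b by auto
  then have "b \<otimes> d = d \<otimes> b"
    using rist_disjoint_commute[OF len(1) neq fg(1,2)] by (metis phi.hom_mult rist_carrier)
  then have "b \<otimes> d \<otimes> inv b = d" using card by (simp add: G.m_assoc)
  then have "d \<in> rist (\<alpha> b w)" using rist_conj[OF car(2) dw] by simp
  then have "d = \<one>" using rist_disjoint_eq_one[of "\<alpha> b w" w d] b dw by (simp add: act_length)
  then have "x = r'" using d by (metis G.inv_closed G.inv_equality G.inv_inv car'(2) car(4))
  then have "r' \<otimes> r = r \<otimes> r'"
    using G.inv_solve_left[of "r'" r "r' \<otimes> r"] by (simp add: x_def G.m_assoc)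
  then show False using noncomm by simp
qed

text \<open>
  By faithfulness some vertex is moved; its descendants are moved too, so it can be taken below
  the level of \<open>v\<close>.
\<close>

lemma touch_exists: "\<exists>u. length u = length v \<and> touches (\<phi> ` rist v) u"
proof -
  obtain g y where g: "g \<in> rist v" "\<alpha> g y \<noteq> y" by (rule rist_nontrivial)
  then have c: "g \<in> carrier G" by (simp add: rist_carrier)
  have "g \<noteq> \<one>" using g by (auto simp: act_one)
  then have "\<phi> g \<noteq> \<one>" using phi_inj[OF c, of \<one>] by simp
  then obtain x where x: "\<alpha> (\<phi> g) x \<noteq> x" using act_eqI[of "\<phi> g" \<one>] c by (auto simp: act_one)
  define w where "w = x @ replicate (length v) True"
  have "\<alpha> (\<phi> g) w \<noteq> w"
    using rooted_tree_autD(3)[OF tree_aut[of "\<phi> g"], of "length x" w] x c by (auto simp: w_def)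
  moreover have "length v \<le> length w" by (simp add: w_def)
  then have "w \<in> subtree (take (length v) w)" "length (take (length v) w) = length v"
    by (simp_all add: subtree_iff min_def)
  ultimately show ?thesis using g unfolding touches_def by blast
qed

text \<open>
  By \<open>not_both_touch\<close>, choosing a touched vertex for each \<open>v\<close> is injective on the finite level of
  \<open>v\<close>, hence bijective, and so the choice is forced. Uniqueness then yields compatibility with prefixes
  and with \<open>\<phi>\<close>, since the touched vertices are determined by \<open>G\<close> and \<open>\<phi>\<close>.
\<close>

theorem automorphism_induced_by_tree_aut:
  obtains t where "rooted_tree_aut t" "\<And>g v. g \<in> carrier G \<Longrightarrow> t (\<alpha> g v) = \<alpha> (\<phi> g) (t v)"
proof -
  define t where "t v = (SOME u. length u = length v \<and> touches (\<phi> ` rist v) u)" for v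
  have t: "length (t v) = length v" "touches (\<phi> ` rist v) (t v)" for v
    using someI_ex[OF touch_exists[of v]] by (simp_all add: t_def)
  have inj: "v = v'" if "t v = t v'" for v v'
    using not_both_touch[of v v' "t v"] t[of v] t[of v'] that by metis
  have surj: "\<exists>v. length v = length u \<and> t v = u" for u
  proof -
    have "t ` level (length u) = level (length u)"
    proof (rule endo_inj_surj)
      show "finite (level (length u))"
        using finite_lists_length_eq[of "UNIV :: bool set" "length u"] by (simp add: level_def)
      show "inj_on t (level (length u))" using inj by (auto simp: inj_on_def)
    qed (auto simp: level_def t)
    moreover have "u \<in> level (length u)" by (simp add: level_def)
    ultimately have "u \<in> t ` level (length u)" by simp
    then show ?thesis by (auto simp: level_def)
  qed
  have unique: "u = t v" if len: "length u = length v" and u: "touches (\<phi> ` rist v) u" for u v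
  proof -
    obtain v' where v': "length v' = length u" "t v' = u" using surj by blast
    then have "v = v'" using not_both_touch[of v v' u] t[of v'] len u by metis
    then show ?thesis using v' by simp
  qed
  show ?thesis
  proof
    show "rooted_tree_aut t"
      unfolding rooted_tree_aut_iff
    proof (intro conjI allI)
      show "bij t" using inj surj by (metis bijI injI surj_def)
      show "length (t v) = length v" for v by (rule t)
      show "t (take k v) = take k (t v)" for k v
      proof (rule unique[symmetric])
        show "length (take k (t v)) = length (take k v)" by (simp add: t)
        have "rist v \<subseteq> rist (take k v)" "subtree (t v) \<subseteq> subtree (take k (t v))"
          using subtree_take by (auto intro!: rist_mono)
        then show "touches (\<phi> ` rist (take k v)) (take k (t v))"
          using t(2)[of v] unfolding touches_def by blast
      qed
    qed
    show "t (\<alpha> g v) = \<alpha> (\<phi> g) (t v)" if g: "g \<in> carrier G" for g v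
    proof (rule unique[symmetric])
      show "length (\<alpha> (\<phi> g) (t v)) = length (\<alpha> g v)" using g by (simp add: act_length t)
      obtain a w where a: "a \<in> \<phi> ` rist v" and w: "w \<in> subtree (t v)" "\<alpha> a w \<noteq> w"
        using t(2)[of v] by (auto simp: touches_def)
      have c: "a \<in> carrier G" "\<phi> g \<in> carrier G" using a g by (auto simp: phi_rist_carrier)
      let ?b = "\<phi> g \<otimes> a \<otimes> inv (\<phi> g)"
      have "\<alpha> ?b (\<alpha> (\<phi> g) w) = \<alpha> (\<phi> g) (\<alpha> a w)" using c by (simp add: act_mult act_inv)
      then have "\<alpha> ?b (\<alpha> (\<phi> g) w) \<noteq> \<alpha> (\<phi> g) w" using w c by (simp add: act_eq_iff)
      moreover have "\<alpha> (\<phi> g) w \<in> subtree (\<alpha> (\<phi> g) (t v))" using w c by (simp add: act_subtree)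
      ultimately show "touches (\<phi> ` rist (\<alpha> g v)) (\<alpha> (\<phi> g) (t v))"
        using phi_rist_conj[OF g a] unfolding touches_def by blast
    qed
  qed
qed

end

section \<open>Reidemeister classes as conjugacy classes in a coset\<close>

lemma image_branch_tree_group: "branch_tree_group (\<alpha> ` carrier G)"
proof
  fix p q assume "p \<in> \<alpha> ` carrier G"
  then obtain g where g: "g \<in> carrier G" "p = \<alpha> g" by auto
  show "rooted_tree_aut p" using g tree_aut by simp
  then show "bij p" by (rule rooted_tree_autD)
  show "perm_inv p \<in> \<alpha> ` carrier G" using g act_inv_eq by (metis G.inv_closed imageI)
  assume "q \<in> \<alpha> ` carrier G"
  then obtain h where h: "h \<in> carrier G" "q = \<alpha> h" by auto
  then have "p \<circ> q = \<alpha> (g \<otimes> h)" using g by (simp add: act_mult fun_eq_iff)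
  then show "p \<circ> q \<in> \<alpha> ` carrier G" using g h by simp
next
  show "id \<in> \<alpha> ` carrier G" using act_one by (metis G.one_closed imageI)
next
  fix v w :: vertex assume "length v = length w"
  then have "v \<in> subtree_level [] (length v)" "w \<in> subtree_level [] (length v)" "[] \<in> level 0"
    by (simp_all add: subtree_level_def subtree_def level_def)
  moreover obtain H where H: "characteristic_subgroup H G"
      "\<forall>v \<in> level 0. \<forall>k. \<forall>x \<in> subtree_level v k. \<forall>y \<in> subtree_level v k. \<exists>h \<in> H. \<alpha> h x = y"
    using saturated[of 0] by blast
  ultimately have "\<exists>h\<in>H. \<alpha> h v = w" by blast
  moreover have "H \<subseteq> carrier G"
    using H(1) by (simp add: characteristic_subgroup_def subgroup.subset)
  ultimately show "\<exists>g\<in>\<alpha> ` carrier G. g v = w" by blast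
next
  fix v
  obtain g w where "g \<in> rist v" "\<alpha> g w \<noteq> w" by (rule rist_nontrivial)
  then show "\<exists>g\<in>\<alpha> ` carrier G. g \<noteq> id \<and> (\<forall>w. w \<notin> subtree v \<longrightarrow> g w = w)"
    by (intro bexI[of _ "\<alpha> g"]) (auto simp: rist_def)
qed

text \<open>
  From \<open>y = g x \<phi>(g\<inverse>)\<close> and \<open>\<alpha> (\<phi> (g\<inverse>)) \<circ> t = t \<circ> \<alpha> (g\<inverse>)\<close> it follows that \<open>\<alpha> y \<circ> t\<close> is the
  conjugate of \<open>\<alpha> x \<circ> t\<close> by \<open>\<alpha> g\<close>. So \<open>x \<mapsto> \<alpha> x \<circ> t\<close> maps Reidemeister classes to conjugacy
  classes in the coset.
\<close>

lemma infinite_reidemeister_classes: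
  assumes phi: "\<phi> \<in> iso G G"
  shows "infinite (reidemeister_classes G \<phi>)"
proof
  assume finite: "finite (reidemeister_classes G \<phi>)"
  obtain t where t: "rooted_tree_aut t" "\<And>g v. g \<in> carrier G \<Longrightarrow> t (\<alpha> g v) = \<alpha> (\<phi> g) (t v)"
    using automorphism_induced_by_tree_aut[OF phi] by blast
  have bij_t: "bij t" using rooted_tree_autD(1)[OF t(1)] .
  have phi_closed: "\<phi> g \<in> carrier G" if "g \<in> carrier G" for g
    using phi that by (auto simp: iso_def hom_def)
  interpret \<Gamma>: branch_tree_group "\<alpha> ` carrier G" by (rule image_branch_tree_group)
  define F where "F x = \<alpha> x \<circ> t" for x
  have "conj_by t (\<alpha> g) = \<alpha> (\<phi> g)" if "g \<in> carrier G" for g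
    unfolding conj_by_eq_iff[OF bij_t] using that t(2) by (simp add: fun_eq_iff)
  then have normal: "conj_by t g \<in> \<alpha> ` carrier G" if "g \<in> \<alpha> ` carrier G" for g
    using that phi_closed by (metis (no_types, lifting) imageE imageI)
  have cls: "(\<lambda>g. conj_by g (F x)) ` \<alpha> ` carrier G = F ` (twisted_conj G \<phi> `` {x})"
    if x: "x \<in> carrier G" for x
  proof -
    have F: "conj_by (\<alpha> g) (F x) = F (g \<otimes> x \<otimes> \<phi> (inv g))" if g: "g \<in> carrier G" for g
    proof -
      have "\<alpha> (\<phi> (inv g)) (t (\<alpha> g v)) = t v" for v
        using t(2)[of "inv g" "\<alpha> g v"] g by (simp add: act_inv)
      then show ?thesis
        unfolding conj_by_eq_iff[OF rooted_tree_autD(1)[OF tree_aut[OF g]]]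
        using g x phi_closed by (simp add: F_def fun_eq_iff act_mult)
    qed
    have "twisted_conj G \<phi> `` {x} = (\<lambda>g. g \<otimes> x \<otimes> \<phi> (inv g)) ` carrier G"
      using x phi_closed by (auto simp: twisted_conj_def)
    then show ?thesis using F by (simp add: image_image cong: image_cong)
  qed
  have "(\<lambda>s. (\<lambda>g. conj_by g s) ` \<alpha> ` carrier G) ` (\<lambda>g. g \<circ> t) ` \<alpha> ` carrier G
      = (\<lambda>x. (\<lambda>g. conj_by g (F x)) ` \<alpha> ` carrier G) ` carrier G"
    by (simp add: image_image F_def)
  also have "\<dots> = (\<lambda>C. F ` C) ` reidemeister_classes G \<phi>"
    using cls by (auto simp: reidemeister_classes_def quotient_def)
  finally show False
    using \<Gamma>.infinite_conj_classes_coset[OF t(1) normal] finite by simp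
qed

end

theorem theorem7p8:
  fixes G :: "('a, 'b) monoid_scheme" and \<alpha> :: "'a \<Rightarrow> vertex \<Rightarrow> vertex"
  assumes "saturated_weakly_branch_group G \<alpha>"
  shows "R_infinity G"
  using saturated_weakly_branch_group.infinite_reidemeister_classes[OF assms]
  by (simp add: R_infinity_def reidemeister_number_def)

end
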